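(* Let $G$ be a nontrivial finite simple connected graph. Then $$DSO(G)\ge \frac{SO(G)^2}{\sqrt{F(G)\,HM(G)}}.$$ Equality holds if and only if $G$ is either a regular graph or a bipartite semiregular graph.
   Context: For a finite simple graph $G=(V(G),E(G))$, $d_u$ denotes the degree of the vertex $u$. A connected graph is nontrivial if it has at least two vertices (equivalently, at least one edge). The Diminished Sombor index is $DSO(G)=\sum_{uv\in E(G)}\frac{\sqrt{d_u^2+d_v^2}}{d_u+d_v}$. The Sombor index is $SO(G)=\sum_{uv\in E(G)}\sqrt{d_u^2+d_v^2}$, the forgotten index is $F(G)=\sum_{uv\in E(G)}(d_u^2+d_v^2)$, and the hyper-Zagreb index is $HM(G)=\sum_{uv\in E(G)}(d_u+d_v)^2$. A graph is bipartite semiregular if it is bipartite with a bipartition $(A,B)$ such that all vertices of $A$ have the same degree and all vertices of $B$ have the same degree. *)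

theory Defs
  imports Complex_Main "Graph_Theory.Graph_Theory"
begin

text \<open>
  A finite simple graph is a \<^locale>\<open>pair_graph\<close>: finite, symmetric, without loops, and without
  parallel arcs because the arcs form a set of pairs. An undirected edge \<open>uv\<close> is represented by
  the two arcs \<open>(u,v)\<close> and \<open>(v,u)\<close>, so sums over edges range over the unordered edges
  \<open>{u,v}\<close> below, which counts each edge once. For the same reason, the degree of a vertex
  in the undirected sense is its out-degree.
\<close>

definition uedges :: "'a pair_pre_digraph \<Rightarrow> 'a set set" where
  "uedges G = {{u, v} | u v. (u, v) \<in> parcs G}"

definition deg :: "'a pair_pre_digraph \<Rightarrow> 'a \<Rightarrow> nat" where
  "deg G v = out_degree (with_proj G) v"

text \<open>
  In the summands below, an edge \<open>e = {u,v}\<close> has \<open>u \<noteq> v\<close>; hence a sum over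
  the elements of \<open>e\<close> is the sum of exactly two terms, one for \<open>u\<close> and one for \<open>v\<close>.
\<close>

definition DSO :: "'a pair_pre_digraph \<Rightarrow> real" where
  "DSO G = (\<Sum>e\<in>uedges G. sqrt (\<Sum>u\<in>e. (real (deg G u))\<^sup>2) / (\<Sum>u\<in>e. real (deg G u)))"

definition SO :: "'a pair_pre_digraph \<Rightarrow> real" where
  "SO G = (\<Sum>e\<in>uedges G. sqrt (\<Sum>u\<in>e. (real (deg G u))\<^sup>2))"

definition forgotten_index :: "'a pair_pre_digraph \<Rightarrow> real" where
  "forgotten_index G = (\<Sum>e\<in>uedges G. \<Sum>u\<in>e. (real (deg G u))\<^sup>2)"

definition HM :: "'a pair_pre_digraph \<Rightarrow> real" where
  "HM G = (\<Sum>e\<in>uedges G. (\<Sum>u\<in>e. real (deg G u))\<^sup>2)"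

definition regular_graph :: "'a pair_pre_digraph \<Rightarrow> bool" where
  "regular_graph G \<longleftrightarrow> (\<exists>r. \<forall>v\<in>pverts G. deg G v = r)"

definition bipartition :: "'a pair_pre_digraph \<Rightarrow> 'a set \<Rightarrow> 'a set \<Rightarrow> bool" where
  "bipartition G A B \<longleftrightarrow> A \<union> B = pverts G \<and> A \<inter> B = {} \<and>
     (\<forall>(u, v)\<in>parcs G. (u \<in> A \<and> v \<in> B) \<or> (u \<in> B \<and> v \<in> A))"

definition bipartite_semiregular :: "'a pair_pre_digraph \<Rightarrow> bool" where
  "bipartite_semiregular G \<longleftrightarrow> (\<exists>A B. bipartition G A B \<and>
     (\<exists>a. \<forall>v\<in>A. deg G v = a) \<and> (\<exists>b. \<forall>v\<in>B. deg G v = b))"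

end

theory Submission
  imports Defs
begin

text \<open>
  For an edge \<open>e = uv\<close> put \<open>x\<^sub>e = sqrt (d\<^sub>u\<^sup>2 + d\<^sub>v\<^sup>2)\<close> and \<open>y\<^sub>e = d\<^sub>u + d\<^sub>v\<close>. Then the four indices are
  the sums of \<open>x/y\<close>, \<open>x\<close>, \<open>x\<^sup>2\<close> and \<open>y\<^sup>2\<close>, and the inequality follows from applying
  Cauchy--Schwarz twice, with the sum of \<open>x y\<close> as the intermediate quantity:
  \<open>(\<Sum>x)\<^sup>2 \<le> (\<Sum>x/y) (\<Sum>x y) \<le> (\<Sum>x/y) sqrt ((\<Sum>x\<^sup>2) (\<Sum>y\<^sup>2))\<close>.
  Both steps are the weighted inequality \<open>weighted_Cauchy_Schwarz\<close>, whose equality case says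
  that a function is constant: the first step has weight \<open>x/y\<close> and function \<open>y\<close>, the second has
  weight \<open>y\<^sup>2\<close> and function \<open>x/y\<close>. Hence equality holds throughout iff \<open>y\<close> and \<open>x\<close> are constant
  (\<open>sum_quotient_eq_iff\<close>).

  Since \<open>d\<^sub>u + d\<^sub>v\<close> and \<open>d\<^sub>u\<^sup>2 + d\<^sub>v\<^sup>2\<close> determine the unordered pair of degrees, constancy of \<open>x\<close> and \<open>y\<close>
  means that every edge has the same two end degrees \<open>a\<close> and \<open>b\<close>. Connectedness leaves no isolated
  vertex, so every vertex has degree \<open>a\<close> or \<open>b\<close>: the graph is regular if \<open>a = b\<close>, and otherwise
  the two degree classes form a semiregular bipartition.
\<close>

section \<open>The inequality for positive functions\<close>

text \<open>
  The difference of the two sides is \<open>\<Sum>w\<close> times the variance-like sum \<open>\<Sum>w (g - m)\<^sup>2\<close>, where \<open>m\<close> is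
  the \<open>w\<close>-weighted mean of \<open>g\<close>. It vanishes only if \<open>g\<close> equals \<open>m\<close> everywhere.
\<close>

lemma weighted_Cauchy_Schwarz:
  fixes w g :: "'b \<Rightarrow> real"
  assumes fin: "finite E" and pos: "\<And>e. e \<in> E \<Longrightarrow> w e > 0"
  shows "(\<Sum>e\<in>E. w e * g e)\<^sup>2 \<le> (\<Sum>e\<in>E. w e) * (\<Sum>e\<in>E. w e * (g e)\<^sup>2)"
    and "(\<Sum>e\<in>E. w e * g e)\<^sup>2 = (\<Sum>e\<in>E. w e) * (\<Sum>e\<in>E. w e * (g e)\<^sup>2)
      \<longleftrightarrow> (\<exists>c. \<forall>e\<in>E. g e = c)"
proof -
  define W where "W = (\<Sum>e\<in>E. w e)"
  define T where "T = (\<Sum>e\<in>E. w e * g e)"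
  define U where "U = (\<Sum>e\<in>E. w e * (g e)\<^sup>2)"
  define V where "V = (\<Sum>e\<in>E. w e * (g e - T / W)\<^sup>2)"
  have "T\<^sup>2 \<le> W * U \<and> (T\<^sup>2 = W * U \<longleftrightarrow> (\<exists>c. \<forall>e\<in>E. g e = c))"
  proof (cases "E = {}")
    case True
    then show ?thesis by (simp add: W_def T_def U_def)
  next
    case False
    have W: "W > 0" unfolding W_def using fin False pos by (intro sum_pos) auto
    have "V = (\<Sum>e\<in>E. w e * (g e)\<^sup>2 - 2 * (T / W) * (w e * g e) + (T / W)\<^sup>2 * w e)"
      unfolding V_def by (intro sum.cong) (auto simp: power2_eq_square algebra_simps)
    also have "\<dots> = U - 2 * (T / W) * T + (T / W)\<^sup>2 * W"
      by (simp only: sum.distrib sum_subtractf sum_distrib_left[symmetric] U_def T_def W_def)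
    finally have V: "W * V = W * U - T\<^sup>2"
      using W by (simp add: field_simps power2_eq_square)
    have V0: "V \<ge> 0" unfolding V_def using pos by (intro sum_nonneg) (simp add: less_imp_le)
    have "0 \<le> W * V" using V0 W by simp
    then have "T\<^sup>2 \<le> W * U" using V by linarith
    moreover have "(\<exists>c. \<forall>e\<in>E. g e = c)" if "T\<^sup>2 = W * U"
    proof -
      have "V = 0" using V W that by simp
      then have "\<forall>e\<in>E. w e * (g e - T / W)\<^sup>2 = 0"
        unfolding V_def using fin pos by (subst (asm) sum_nonneg_eq_0_iff) (auto simp: less_imp_le)
      then have "g e = T / W" if "e \<in> E" for e using pos[OF that] that by fastforce
      then show ?thesis by blast
    qed
    moreover have "T\<^sup>2 = W * U" if "\<forall>e\<in>E. g e = c" for c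
    proof -
      have "T = W * c" "U = W * c\<^sup>2"
        using that by (simp_all add: T_def U_def W_def sum_distrib_right)
      then show ?thesis by (simp add: power2_eq_square)
    qed
    ultimately show ?thesis by blast
  qed
  then show "(\<Sum>e\<in>E. w e * g e)\<^sup>2 \<le> (\<Sum>e\<in>E. w e) * (\<Sum>e\<in>E. w e * (g e)\<^sup>2)"
    and "(\<Sum>e\<in>E. w e * g e)\<^sup>2 = (\<Sum>e\<in>E. w e) * (\<Sum>e\<in>E. w e * (g e)\<^sup>2)
      \<longleftrightarrow> (\<exists>c. \<forall>e\<in>E. g e = c)"
    unfolding W_def T_def U_def by blast+
qed

text \<open>
  Since \<open>\<Sum>x/y\<close> is positive, equality in the chain
  \<open>(\<Sum>x)\<^sup>2 \<le> (\<Sum>x/y) (\<Sum>x y) \<le> (\<Sum>x/y) sqrt ((\<Sum>x\<^sup>2) (\<Sum>y\<^sup>2))\<close> forces equality in both steps, that is,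
  constancy of \<open>y\<close> and of \<open>x/y\<close>.
\<close>

lemma
  fixes x y :: "'b \<Rightarrow> real"
  assumes fin: "finite E" and ne: "E \<noteq> {}"
    and x: "\<And>e. e \<in> E \<Longrightarrow> x e > 0" and y: "\<And>e. e \<in> E \<Longrightarrow> y e > 0"
  shows sum_quotient_ge:
      "(\<Sum>e\<in>E. x e)\<^sup>2 / sqrt ((\<Sum>e\<in>E. (x e)\<^sup>2) * (\<Sum>e\<in>E. (y e)\<^sup>2)) \<le> (\<Sum>e\<in>E. x e / y e)"
    and sum_quotient_eq_iff:
      "(\<Sum>e\<in>E. x e / y e) = (\<Sum>e\<in>E. x e)\<^sup>2 / sqrt ((\<Sum>e\<in>E. (x e)\<^sup>2) * (\<Sum>e\<in>E. (y e)\<^sup>2))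
        \<longleftrightarrow> (\<exists>c. \<forall>e\<in>E. x e = c) \<and> (\<exists>c. \<forall>e\<in>E. y e = c)"
proof -
  define S where "S = (\<Sum>e\<in>E. x e)"
  define P where "P = (\<Sum>e\<in>E. x e / y e)"
  define Q where "Q = (\<Sum>e\<in>E. x e * y e)"
  define X where "X = (\<Sum>e\<in>E. (x e)\<^sup>2)"
  define Y where "Y = (\<Sum>e\<in>E. (y e)\<^sup>2)"
  have P: "P > 0" and Q: "Q > 0" and X: "X > 0" and Y: "Y > 0"
    unfolding P_def Q_def X_def Y_def
    by (rule sum_pos[OF fin ne], use x y in force)+
  have y_nz: "y e \<noteq> 0" if "e \<in> E" for e using y[OF that] by simp
  have S_eq: "(\<Sum>e\<in>E. x e / y e * y e) = S"
    unfolding S_def by (intro sum.cong) (auto simp: y_nz)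
  have Q_eq: "(\<Sum>e\<in>E. x e / y e * (y e)\<^sup>2) = Q"
    unfolding Q_def by (intro sum.cong) (auto simp: power2_eq_square y_nz)
  have Q_eq': "(\<Sum>e\<in>E. (y e)\<^sup>2 * (x e / y e)) = Q"
    unfolding Q_def by (intro sum.cong) (auto simp: power2_eq_square y_nz)
  have X_eq: "(\<Sum>e\<in>E. (y e)\<^sup>2 * (x e / y e)\<^sup>2) = X"
    unfolding X_def
    by (intro sum.cong) (auto simp: power_divide y_nz)
  have wxy: "x e / y e > 0" if "e \<in> E" for e using x y that by simp
  have wyy: "(y e)\<^sup>2 > 0" if "e \<in> E" for e using y_nz[OF that] by simp
  have SPQ: "S\<^sup>2 \<le> P * Q" and SPQ_eq: "S\<^sup>2 = P * Q \<longleftrightarrow> (\<exists>c. \<forall>e\<in>E. y e = c)"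
    using weighted_Cauchy_Schwarz[OF fin wxy, of "\<lambda>e. e" y]
    unfolding S_eq Q_eq P_def by auto
  have QXY: "Q\<^sup>2 \<le> X * Y" and QXY_eq: "Q\<^sup>2 = X * Y \<longleftrightarrow> (\<exists>c. \<forall>e\<in>E. x e / y e = c)"
    using weighted_Cauchy_Schwarz[OF fin wyy, of "\<lambda>e. e" "\<lambda>e. x e / y e"]
    unfolding Q_eq' X_eq Y_def by (auto simp: mult.commute)
  define R where "R = sqrt (X * Y)"
  have R: "R > 0" using X Y by (simp add: R_def)
  have QR: "Q \<le> R" unfolding R_def using QXY by (rule real_le_rsqrt)
  have QR_eq: "Q = R \<longleftrightarrow> Q\<^sup>2 = X * Y"
    unfolding R_def using X Y Q by (auto simp: real_sqrt_unique)
  have PQR: "P * Q \<le> P * R" using P QR by simp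
  have "S\<^sup>2 / R \<le> P" using SPQ PQR R by (simp add: divide_le_eq)
  moreover have "P = S\<^sup>2 / R \<longleftrightarrow> S\<^sup>2 = P * Q \<and> Q = R"
  proof -
    have "P = S\<^sup>2 / R \<longleftrightarrow> S\<^sup>2 = P * R" using R by (auto simp: eq_divide_eq)
    also have "\<dots> \<longleftrightarrow> S\<^sup>2 = P * Q \<and> P * Q = P * R" using SPQ PQR by linarith
    also have "\<dots> \<longleftrightarrow> S\<^sup>2 = P * Q \<and> Q = R" using P by simp
    finally show ?thesis .
  qed
  moreover have "(\<exists>c. \<forall>e\<in>E. y e = c) \<and> (\<exists>c. \<forall>e\<in>E. x e / y e = c)
      \<longleftrightarrow> (\<exists>c. \<forall>e\<in>E. x e = c) \<and> (\<exists>c. \<forall>e\<in>E. y e = c)"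
  proof -
    have "x e = b * a" if "e \<in> E" "y e = a" "x e / y e = b" for e a b
      using that y_nz[OF that(1)] by auto
    then have "\<exists>c. \<forall>e\<in>E. x e = c" if "\<forall>e\<in>E. y e = a" "\<forall>e\<in>E. x e / y e = b" for a b
      using that by (intro exI[of _ "b * a"]) simp
    moreover have "\<exists>c. \<forall>e\<in>E. x e / y e = c" if "\<forall>e\<in>E. x e = a" "\<forall>e\<in>E. y e = b" for a b
      using that by (intro exI[of _ "a / b"]) simp
    ultimately show ?thesis by meson
  qed
  ultimately show
    "(\<Sum>e\<in>E. x e)\<^sup>2 / sqrt ((\<Sum>e\<in>E. (x e)\<^sup>2) * (\<Sum>e\<in>E. (y e)\<^sup>2)) \<le> (\<Sum>e\<in>E. x e / y e)"
    "(\<Sum>e\<in>E. x e / y e) = (\<Sum>e\<in>E. x e)\<^sup>2 / sqrt ((\<Sum>e\<in>E. (x e)\<^sup>2) * (\<Sum>e\<in>E. (y e)\<^sup>2))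
        \<longleftrightarrow> (\<exists>c. \<forall>e\<in>E. x e = c) \<and> (\<exists>c. \<forall>e\<in>E. y e = c)"
    using SPQ_eq QXY_eq QR_eq unfolding R_def S_def P_def X_def Y_def by simp_all
qed

section \<open>Edges and degrees\<close>

lemma (in pair_graph) finite_uedges: "finite (uedges G)"
proof -
  have "uedges G = (\<lambda>(u, v). {u, v}) ` parcs G" unfolding uedges_def by auto
  then show ?thesis by simp
qed

lemma (in pair_graph) sum_over_arc_ends:
  assumes "(u, v) \<in> parcs G"
  shows "(\<Sum>z\<in>{u, v}. f z) = f u + (f v :: real)"
  using no_loops'[OF assms] by simp

lemma (in pair_graph) deg_pos:
  assumes "(u, v) \<in> parcs G"
  shows "deg G u > 0"
proof -
  have "(u, v) \<in> out_arcs G u" using assms by simp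
  moreover have "finite (out_arcs G u)" by (rule finite_out_arcs)
  ultimately show ?thesis unfolding deg_def out_degree_def by (metis card_gt_0_iff empty_iff)
qed

text \<open>
  A walk from \<open>u\<close> to any second vertex starts with an arc out of \<open>u\<close>.
\<close>

lemma (in pair_graph) connected_imp_no_isolated:
  assumes con: "Digraph_Component.connected (with_proj G)"
    and card: "card (pverts G) \<ge> 2" and u: "u \<in> pverts G"
  obtains v where "(u, v) \<in> parcs G"
proof -
  have "\<not> pverts G \<subseteq> {u}"
    using card card_mono[of "{u}" "pverts G"] by auto
  then obtain v where v: "v \<in> pverts G" "v \<noteq> u" by blast
  have "u \<rightarrow>\<^sup>*\<^bsub>mk_symmetric G\<^esub> v"
    using con u v unfolding connected_def strongly_connected_def by simp
  then have "u \<rightarrow>\<^sup>*\<^bsub>G\<^esub> v" using reachable_mk_symmetric_eq[OF sym_arcs] by blast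
  then show thesis
    using v(2) that by (cases rule: converse_reachable_cases) auto
qed

text \<open>
  The sum and the sum of squares fix the product \<open>a b\<close>, hence the polynomial with roots \<open>a\<close> and \<open>b\<close>.
\<close>

lemma pair_eq_of_sum_and_sum_squares:
  fixes a b c d :: real
  assumes s: "c + d = a + b" and q: "c\<^sup>2 + d\<^sup>2 = a\<^sup>2 + b\<^sup>2"
  shows "c = a \<and> d = b \<or> c = b \<and> d = a"
proof -
  have "d = a + b - c" using s by simp
  then have "(c - a) * (c - b) = 0" using q by algebra
  then show ?thesis using s by auto
qed

section \<open>The extremal graphs\<close>

definition uniform_edge_degrees :: "'a pair_pre_digraph \<Rightarrow> nat \<Rightarrow> nat \<Rightarrow> bool" where
  "uniform_edge_degrees G a b \<longleftrightarrow> (\<forall>u v. (u, v) \<in> parcs G \<longrightarrow> {deg G u, deg G v} = {a, b})"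

lemma uniform_edge_degreesD:
  assumes "uniform_edge_degrees G a b" "(u, v) \<in> parcs G"
  shows "deg G u = a \<and> deg G v = b \<or> deg G u = b \<and> deg G v = a"
  using assms unfolding uniform_edge_degrees_def doubleton_eq_iff by simp

text \<open>
  Absence of isolated vertices carries the condition on edges over to all vertices. If \<open>a = b\<close> the
  graph is regular, possibly without being bipartite; if \<open>a \<noteq> b\<close> the two degree classes are disjoint
  and every edge joins one to the other.
\<close>

lemma (in pair_graph) uniform_edge_degrees_iff:
  assumes noiso: "\<And>u. u \<in> pverts G \<Longrightarrow> \<exists>v. (u, v) \<in> parcs G"
  shows "(\<exists>a b. uniform_edge_degrees G a b)
    \<longleftrightarrow> regular_graph G \<or> bipartite_semiregular G"
proof
  assume "\<exists>a b. uniform_edge_degrees G a b"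
  then obtain a b where ab: "uniform_edge_degrees G a b" by blast
  have verts: "deg G u = a \<or> deg G u = b" if "u \<in> pverts G" for u
  proof -
    obtain v where "(u, v) \<in> parcs G" using noiso[OF \<open>u \<in> pverts G\<close>] by blast
    from uniform_edge_degreesD[OF ab this] show ?thesis by linarith
  qed
  show "regular_graph G \<or> bipartite_semiregular G"
  proof (cases "a = b")
    case True
    then show ?thesis using verts unfolding regular_graph_def by blast
  next
    case False
    define A where "A = {u \<in> pverts G. deg G u = a}"
    define B where "B = {u \<in> pverts G. deg G u = b}"
    have "A \<union> B = pverts G" "A \<inter> B = {}"
      using verts False by (auto simp: A_def B_def)
    moreover have "u \<in> A \<and> v \<in> B \<or> u \<in> B \<and> v \<in> A" if uv: "(u, v) \<in> parcs G" for u v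
      using uniform_edge_degreesD[OF ab uv] in_arcsD1[OF uv] in_arcsD2[OF uv]
      by (auto simp: A_def B_def)
    ultimately have "bipartition G A B" unfolding bipartition_def by blast
    then have "bipartite_semiregular G"
      unfolding bipartite_semiregular_def A_def B_def by blast
    then show ?thesis ..
  qed
next
  assume "regular_graph G \<or> bipartite_semiregular G"
  then show "\<exists>a b. uniform_edge_degrees G a b"
  proof
    assume "regular_graph G"
    then obtain r where "\<forall>v\<in>pverts G. deg G v = r" unfolding regular_graph_def by blast
    then have "uniform_edge_degrees G r r"
      unfolding uniform_edge_degrees_def by (auto dest: in_arcsD1 in_arcsD2)
    then show ?thesis by blast
  next
    assume "bipartite_semiregular G"
    then obtain A B a b where "bipartition G A B" "\<forall>v\<in>A. deg G v = a" "\<forall>v\<in>B. deg G v = b"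
      unfolding bipartite_semiregular_def by blast
    then have "uniform_edge_degrees G a b"
      unfolding uniform_edge_degrees_def bipartition_def by fastforce
    then show ?thesis by blast
  qed
qed

text \<open>
  This translates the equality condition of \<open>sum_quotient_eq_iff\<close> for \<open>x\<close> and \<open>y\<close> into one on degrees:
  the square root is injective, so \<open>pair_eq_of_sum_and_sum_squares\<close> applies to any two edges.
\<close>

lemma (in pair_graph) constant_edge_sums_iff:
  assumes ne: "parcs G \<noteq> {}"
  shows "(\<exists>c. \<forall>e\<in>uedges G. sqrt (\<Sum>u\<in>e. (real (deg G u))\<^sup>2) = c)
      \<and> (\<exists>c. \<forall>e\<in>uedges G. (\<Sum>u\<in>e. real (deg G u)) = c)
    \<longleftrightarrow> (\<exists>a b. uniform_edge_degrees G a b)"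
    (is "?L \<longleftrightarrow> ?R")
proof
  assume ?L
  then obtain p s where
    p: "\<And>e. e \<in> uedges G \<Longrightarrow> sqrt (\<Sum>u\<in>e. (real (deg G u))\<^sup>2) = p" and
    s: "\<And>e. e \<in> uedges G \<Longrightarrow> (\<Sum>u\<in>e. real (deg G u)) = s" by blast
  have arc: "sqrt ((real (deg G u))\<^sup>2 + (real (deg G v))\<^sup>2) = p"
      "real (deg G u) + real (deg G v) = s"
    if uv: "(u, v) \<in> parcs G" for u v
  proof -
    have "{u, v} \<in> uedges G" using uv unfolding uedges_def by blast
    then show "sqrt ((real (deg G u))\<^sup>2 + (real (deg G v))\<^sup>2) = p"
        "real (deg G u) + real (deg G v) = s"
      using p[of "{u, v}"] s[of "{u, v}"] by (simp_all only: sum_over_arc_ends[OF uv])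
  qed
  \<comment> \<open>By constancy, the end degrees of any one arc can serve as \<open>a\<close> and \<open>b\<close>.\<close>
  obtain u0 v0 where uv0: "(u0, v0) \<in> parcs G" using ne by auto
  have "{deg G u, deg G v} = {deg G u0, deg G v0}"
    if uv: "(u, v) \<in> parcs G" for u v
  proof -
    have "sqrt ((real (deg G u))\<^sup>2 + (real (deg G v))\<^sup>2)
        = sqrt ((real (deg G u0))\<^sup>2 + (real (deg G v0))\<^sup>2)"
      using arc(1)[OF uv] arc(1)[OF uv0] by simp
    then have "(real (deg G u))\<^sup>2 + (real (deg G v))\<^sup>2 = (real (deg G u0))\<^sup>2 + (real (deg G v0))\<^sup>2"
      by (simp only: real_sqrt_eq_iff)
    from pair_eq_of_sum_and_sum_squares[OF _ this] show ?thesis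
      using arc(2)[OF uv] arc(2)[OF uv0] by (simp add: doubleton_eq_iff)
  qed
  then have "uniform_edge_degrees G (deg G u0) (deg G v0)"
    unfolding uniform_edge_degrees_def by blast
  then show ?R by blast
next
  assume ?R
  then obtain a b where ab: "uniform_edge_degrees G a b" by blast
  have "(\<Sum>u\<in>e. (real (deg G u))\<^sup>2) = (real a)\<^sup>2 + (real b)\<^sup>2 \<and> (\<Sum>u\<in>e. real (deg G u)) = real a + real b"
    if "e \<in> uedges G" for e
  proof -
    from that obtain u v where e: "e = {u, v}" and uv: "(u, v) \<in> parcs G"
      unfolding uedges_def by blast
    show ?thesis unfolding e sum_over_arc_ends[OF uv] using uniform_edge_degreesD[OF ab uv] by auto
  qed
  then show ?L by simp
qed

theorem theorem14:
  fixes G :: "'a pair_pre_digraph"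
  assumes "pair_graph G"
    and "Digraph_Component.connected (with_proj G)"
    and "card (pverts G) \<ge> 2"
  shows "DSO G \<ge> (SO G)\<^sup>2 / sqrt (forgotten_index G * HM G)
    \<and> (DSO G = (SO G)\<^sup>2 / sqrt (forgotten_index G * HM G)
        \<longleftrightarrow> regular_graph G \<or> bipartite_semiregular G)"
proof -
  interpret pair_graph G by fact
  define x where "x e = sqrt (\<Sum>u\<in>e. (real (deg G u))\<^sup>2)" for e
  define y where "y e = (\<Sum>u\<in>e. real (deg G u))" for e
  have noiso: "\<exists>v. (u, v) \<in> parcs G" if "u \<in> pverts G" for u
    using connected_imp_no_isolated[OF assms(2,3) that] by blast
  have "pverts G \<noteq> {}" using assms(3) by auto
  then have arcs: "parcs G \<noteq> {}" using noiso by blast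
  then have ne: "uedges G \<noteq> {}" unfolding uedges_def by auto
  have pos: "x e > 0 \<and> y e > 0" if "e \<in> uedges G" for e
  proof -
    from that obtain u v where e: "e = {u, v}" and uv: "(u, v) \<in> parcs G"
      unfolding uedges_def by blast
    show ?thesis
      unfolding x_def y_def e sum_over_arc_ends[OF uv] using deg_pos[OF uv]
      by (simp add: add_pos_nonneg)
  qed
  have forg: "forgotten_index G = (\<Sum>e\<in>uedges G. (x e)\<^sup>2)"
    unfolding forgotten_index_def x_def by (simp add: sum_nonneg)
  have eqs: "DSO G = (\<Sum>e\<in>uedges G. x e / y e)" "SO G = (\<Sum>e\<in>uedges G. x e)"
      "HM G = (\<Sum>e\<in>uedges G. (y e)\<^sup>2)"
    unfolding DSO_def SO_def HM_def x_def y_def by simp_all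
  have "(SO G)\<^sup>2 / sqrt (forgotten_index G * HM G) \<le> DSO G"
    unfolding eqs forg using pos by (intro sum_quotient_ge[OF finite_uedges ne]) auto
  moreover have "DSO G = (SO G)\<^sup>2 / sqrt (forgotten_index G * HM G)
      \<longleftrightarrow> (\<exists>c. \<forall>e\<in>uedges G. x e = c) \<and> (\<exists>c. \<forall>e\<in>uedges G. y e = c)"
    unfolding eqs forg using pos by (intro sum_quotient_eq_iff[OF finite_uedges ne]) auto
  moreover have "\<dots> \<longleftrightarrow> regular_graph G \<or> bipartite_semiregular G"
    using constant_edge_sums_iff[OF arcs] uniform_edge_degrees_iff[OF noiso]
    unfolding x_def y_def by blast
  ultimately show ?thesis by simp
qed

end
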